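(* For all integers $n, m \ge 1$ and all $t_0 \in \mathbb{R}$, $$\int_{-\infty}^{+\infty} \psi_{n,t_0}(t)\,\widetilde{\psi}_{m,t_0}(t)\,dt = \delta_{n,m},$$ where $\psi_{n,t_0}(t) = (-1)^n \delta^{(n)}(t-t_0)$, $\widetilde{\psi}_{m,t_0}(t) = \dfrac{(t-t_0)^m}{m!}$, and $\delta_{n,m}$ is the Kronecker symbol. The integral denotes the pairing of the compactly supported distribution $\psi_{n,t_0}$ with the function $\widetilde{\psi}_{m,t_0} \in C^\infty(\mathbb{R})$.
   Context: $\delta(\cdot - t_0)$ is the Dirac distribution at $t_0$: $\langle \varphi, \delta(\cdot-t_0)\rangle = \int_{-\infty}^{+\infty} \varphi(t)\delta(t-t_0)\,dt := \varphi(t_0)$. The $k$-th derivative $T^{(k)}$ of a distribution $T$ is defined by $\langle \varphi, T^{(k)}\rangle = (-1)^k \langle \varphi^{(k)}, T\rangle$. Distributions of compact support are extended to act on all of $C^\infty(\mathbb{R})$ (complex-valued infinitely differentiable functions on $\mathbb{R}$), so these formulas apply with $\varphi \in C^\infty(\mathbb{R})$ when $T$ is a Dirac distribution or one of its derivatives. The integral notation $\int_{-\infty}^{+\infty} T(t)\varphi(t)\,dt$ means $\langle \varphi, T\rangle$. *)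

theory Defs
  imports "HOL-Analysis.Analysis"
begin

definition vderiv :: "(real \<Rightarrow> complex) \<Rightarrow> real \<Rightarrow> complex" where
  "vderiv f = (\<lambda>t. vector_derivative f (at t))"

definition smooth :: "(real \<Rightarrow> complex) \<Rightarrow> bool" where
  "smooth f \<longleftrightarrow> (\<forall>k t. (vderiv ^^ k) f differentiable (at t))"

lemma smooth_differentiable: "smooth f \<Longrightarrow> (vderiv ^^ k) f differentiable (at t)"
  by (simp add: smooth_def)

lemma smooth_vderiv_pow: "smooth f \<Longrightarrow> smooth ((vderiv ^^ k) f)"
  unfolding smooth_def by (metis comp_apply funpow_add)

lemma vderiv_pow_lincomb:
  assumes "smooth f" "smooth g"
  shows "(vderiv ^^ k) (\<lambda>t. a * f t + b * g t)
    = (\<lambda>t. a * (vderiv ^^ k) f t + b * (vderiv ^^ k) g t)"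
proof (induction k)
  case 0
  show ?case by simp
next
  case (Suc k)
  have "((\<lambda>t. a * (vderiv ^^ k) f t + b * (vderiv ^^ k) g t) has_vector_derivative
      a * vderiv ((vderiv ^^ k) f) t + b * vderiv ((vderiv ^^ k) g) t) (at t)" for t
    unfolding vderiv_def [of "(vderiv ^^ k) _"]
    by (intro has_vector_derivative_add has_vector_derivative_mult_right)
       (use assms smooth_differentiable vector_derivative_works in blast)+
  then have "vderiv (\<lambda>t. a * (vderiv ^^ k) f t + b * (vderiv ^^ k) g t)
    = (\<lambda>t. a * vderiv ((vderiv ^^ k) f) t + b * vderiv ((vderiv ^^ k) g) t)"
    unfolding vderiv_def [of "\<lambda>t. a * _ t + b * _ t"] by (blast intro: vector_derivative_at)
  then show ?case
    by (simp add: Suc)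
qed

lemma smooth_lincomb:
  assumes "smooth f" "smooth g"
  shows "smooth (\<lambda>t. a * f t + b * g t)"
  unfolding smooth_def vderiv_pow_lincomb [OF assms]
  using assms by (auto intro!: differentiable_add differentiable_mult smooth_differentiable)

lemma smooth_zero: "smooth (\<lambda>t. 0)"
proof -
  have "(vderiv ^^ k) (\<lambda>t. 0) = (\<lambda>t. 0)" for k
    by (induction k) (auto simp: vderiv_def)
  then show ?thesis
    by (simp add: smooth_def)
qed

lemma smooth_monomial: "smooth (\<lambda>t. c * complex_of_real (t - t0) ^ m)"
proof -
  have deriv: "((\<lambda>t. c * complex_of_real (t - t0) ^ m) has_vector_derivative
      (c * of_nat m) * complex_of_real (t - t0) ^ (m - 1)) (at t)" for c t m
  proof -
    have "((\<lambda>z. c * (z - of_real t0) ^ m) has_field_derivative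
        (c * of_nat m) * (of_real t - of_real t0) ^ (m - 1)) (at (of_real t))"
      by (auto intro!: derivative_eq_intros)
    from has_vector_derivative_real_field [OF this] show ?thesis
      by simp
  qed
  have "(vderiv ^^ k) (\<lambda>t. c * complex_of_real (t - t0) ^ m) differentiable (at t)" for k t
  proof (induction k arbitrary: c m)
    case 0
    have "((\<lambda>t. c * complex_of_real (t - t0) ^ m) has_vector_derivative
        (c * of_nat m) * complex_of_real (t - t0) ^ (m - 1)) (at t)"
      by (rule deriv)
    then show ?case
      by (simp add: differentiableI_vector)
  next
    case (Suc k)
    have "vderiv (\<lambda>t. c * complex_of_real (t - t0) ^ m)
        = (\<lambda>t. (c * of_nat m) * complex_of_real (t - t0) ^ (m - 1))"
      unfolding vderiv_def using deriv by (blast intro: vector_derivative_at)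
    then show ?case
      using Suc [of "c * of_nat m" "m - 1"] by (simp add: funpow_Suc_right del: funpow.simps)
  qed
  then show ?thesis
    by (simp add: smooth_def)
qed

typedef smooth_fun = "{f :: real \<Rightarrow> complex. smooth f}"
  morphisms sapp Smooth
  using smooth_zero by blast

setup_lifting type_definition_smooth_fun

instantiation smooth_fun :: ab_group_add
begin

lift_definition zero_smooth_fun :: smooth_fun is "\<lambda>t. 0"
  by (rule smooth_zero)

lift_definition plus_smooth_fun :: "smooth_fun \<Rightarrow> smooth_fun \<Rightarrow> smooth_fun"
  is "\<lambda>f g t. f t + g t"
  using smooth_lincomb [of _ _ 1 1] by simp

lift_definition minus_smooth_fun :: "smooth_fun \<Rightarrow> smooth_fun \<Rightarrow> smooth_fun"
  is "\<lambda>f g t. f t - g t"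
  using smooth_lincomb [of _ _ 1 "-1"] by simp

lift_definition uminus_smooth_fun :: "smooth_fun \<Rightarrow> smooth_fun"
  is "\<lambda>f t. - f t"
  using smooth_lincomb [of _ _ "-1" 0] by simp

instance
  by standard (transfer; simp add: algebra_simps)+

end

lift_definition sscale :: "complex \<Rightarrow> smooth_fun \<Rightarrow> smooth_fun" is "\<lambda>c f t. c * f t"
  using smooth_lincomb [of _ _ _ 0] by simp

lift_definition sderiv :: "nat \<Rightarrow> smooth_fun \<Rightarrow> smooth_fun" is "\<lambda>k. vderiv ^^ k"
  by (rule smooth_vderiv_pow)

lemma vector_space_sscale: "vector_space sscale"
  by unfold_locales (transfer; simp add: algebra_simps)+

lemma vector_space_complex: "vector_space ((*) :: complex \<Rightarrow> complex \<Rightarrow> complex)"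
  by unfold_locales (simp_all add: algebra_simps)

lemma sderiv_add: "sderiv k (f + g) = sderiv k f + sderiv k g"
  by transfer (use vderiv_pow_lincomb [of _ _ _ 1 1] in simp)

lemma sderiv_sscale: "sderiv k (sscale c f) = sscale c (sderiv k f)"
  by transfer (use vderiv_pow_lincomb [of _ _ _ _ 0] in simp)

lemma sderiv_sderiv: "sderiv k (sderiv l f) = sderiv (k + l) f"
  by transfer (simp add: funpow_add)

text \<open>Convergence in the Frechet space \<open>C\<^sup>\<infinity>(\<real>)\<close>: locally uniform convergence of all derivatives.\<close>

definition smooth_converges :: "(nat \<Rightarrow> smooth_fun) \<Rightarrow> smooth_fun \<Rightarrow> bool" where
  "smooth_converges F f \<longleftrightarrow>
     (\<forall>k K. compact K \<longrightarrow>
        uniform_limit K (\<lambda>j. sapp (sderiv k (F j))) (sapp (sderiv k f)) sequentially)"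

lemma smooth_converges_sderiv:
  "smooth_converges F f \<Longrightarrow> smooth_converges (\<lambda>j. sderiv l (F j)) (sderiv l f)"
  by (simp add: smooth_converges_def sderiv_sderiv)

lemma smooth_converges_pointwise:
  assumes "smooth_converges F f"
  shows "(\<lambda>j. sapp (F j) t) \<longlonglongrightarrow> sapp f t"
proof -
  have zero: "sderiv 0 g = g" for g
    by transfer simp
  have "uniform_limit {t} (\<lambda>j. sapp (sderiv 0 (F j))) (sapp (sderiv 0 f)) sequentially"
    using assms compact_sing unfolding smooth_converges_def by blast
  then show ?thesis
    unfolding zero by (rule tendsto_uniform_limitI) simp
qed

text \<open>Distributions of compact support, as the continuous linear functionals on
  \<open>C\<^sup>\<infinity>(\<real>)\<close>. This space is metrizable, so continuity is sequential continuity.\<close>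

definition cs_functional :: "(smooth_fun \<Rightarrow> complex) \<Rightarrow> bool" where
  "cs_functional T \<longleftrightarrow> Vector_Spaces.linear sscale (*) T \<and>
     (\<forall>F f. smooth_converges F f \<longrightarrow> (\<lambda>j. T (F j)) \<longlonglongrightarrow> T f)"

lemma cs_functional_iff:
  "cs_functional T \<longleftrightarrow> (\<forall>f g. T (f + g) = T f + T g) \<and> (\<forall>c f. T (sscale c f) = c * T f) \<and>
     (\<forall>F f. smooth_converges F f \<longrightarrow> (\<lambda>j. T (F j)) \<longlonglongrightarrow> T f)"
  using vector_space_sscale vector_space_complex
  by (simp add: cs_functional_def Vector_Spaces.linear_iff)

typedef cs_distribution = "{T. cs_functional T}"
  morphisms pairing_fun CS_Distribution
  by (rule exI [of _ "\<lambda>f. 0"]) (simp add: cs_functional_iff)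

setup_lifting type_definition_cs_distribution

text \<open>\<open>pairing f T\<close> is \<open>\<langle>f, T\<rangle>\<close>, the value denoted by the integral of \<open>T(t) f(t)\<close> over \<open>\<real>\<close>.\<close>

definition pairing :: "smooth_fun \<Rightarrow> cs_distribution \<Rightarrow> complex" where
  "pairing f T = pairing_fun T f"

text \<open>\<open>dirac t0\<close> is \<open>\<delta>(\<cdot> - t0)\<close>.\<close>

lift_definition dirac :: "real \<Rightarrow> cs_distribution" is "\<lambda>t0 f. sapp f t0"
  by (simp add: cs_functional_iff smooth_converges_pointwise plus_smooth_fun.rep_eq sscale.rep_eq)

lift_definition dist_scale :: "complex \<Rightarrow> cs_distribution \<Rightarrow> cs_distribution"
  is "\<lambda>c T f. c * T f"
  by (auto simp: cs_functional_iff algebra_simps intro!: tendsto_mult_left)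

lift_definition dist_deriv :: "nat \<Rightarrow> cs_distribution \<Rightarrow> cs_distribution"
  is "\<lambda>k T f. (-1) ^ k * T (sderiv k f)"
  by (auto simp: cs_functional_iff sderiv_add sderiv_sscale distrib_left mult.left_commute
      smooth_converges_sderiv intro!: tendsto_mult_left)

definition psi :: "nat \<Rightarrow> real \<Rightarrow> cs_distribution" where
  "psi n t0 = dist_scale ((-1) ^ n) (dist_deriv n (dirac t0))"

lift_definition psi_tilde :: "nat \<Rightarrow> real \<Rightarrow> smooth_fun"
  is "\<lambda>m t0 t. complex_of_real ((t - t0) ^ m / fact m)"
  using smooth_monomial [of "1 / fact _"] by simp

end

theory Submission
  imports Defs
begin

text \<open>The sign in \<open>psi\<close> cancels the one in the definition of the distributional
  derivative, so pairing with \<open>psi n t0\<close> evaluates the \<open>n\<close>-th derivative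
  at \<open>t0\<close>. Since \<open>psi_tilde m t0\<close> is a Taylor monomial centred there, that
  value is 1 for \<open>n = m\<close> and 0 otherwise. \<open>vderiv_pow_monomial\<close>
  differentiates; \<open>sderiv_psi_tilde_center\<close> evaluates.\<close>

lemma vderiv_monomial:
  "vderiv (\<lambda>t. c * complex_of_real (t - t0) ^ m)
    = (\<lambda>t. c * of_nat m * complex_of_real (t - t0) ^ (m - 1))"
proof
  fix t
  \<comment> \<open>Differentiate in a complex variable, then restrict to the real line. For
    \<open>m = 0\<close> the truncated exponent is harmless, as the factor \<open>of_nat m\<close>
    is zero.\<close>
  have "((\<lambda>z. c * (z - of_real t0) ^ m) has_field_derivative
      c * of_nat m * (of_real t - of_real t0) ^ (m - 1)) (at (of_real t))"
    by (auto intro!: derivative_eq_intros)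
  from has_vector_derivative_real_field [OF this]
  show "vderiv (\<lambda>t. c * complex_of_real (t - t0) ^ m) t
      = c * of_nat m * complex_of_real (t - t0) ^ (m - 1)"
    unfolding vderiv_def by (intro vector_derivative_at) simp
qed

text \<open>For \<open>k > m\<close> the product vanishes, since it contains the factor with \<open>i = m\<close>.\<close>

lemma vderiv_pow_monomial:
  "(vderiv ^^ k) (\<lambda>t. c * complex_of_real (t - t0) ^ m)
    = (\<lambda>t. c * of_nat (\<Prod>i<k. m - i) * complex_of_real (t - t0) ^ (m - k))"
proof (induction k)
  case 0
  show ?case by simp
next
  case (Suc k)
  have "(vderiv ^^ Suc k) (\<lambda>t. c * complex_of_real (t - t0) ^ m)
      = vderiv (\<lambda>t. c * of_nat (\<Prod>i<k. m - i) * complex_of_real (t - t0) ^ (m - k))"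
    by (simp only: funpow.simps comp_apply Suc)
  also have "\<dots> = (\<lambda>t. c * of_nat (\<Prod>i<k. m - i) * of_nat (m - k)
      * complex_of_real (t - t0) ^ (m - k - 1))"
    by (rule vderiv_monomial)
  finally show ?case
    by (simp add: mult.assoc)
qed

lemma sderiv_psi_tilde_center:
  "sapp (sderiv n (psi_tilde m t0)) t0 = (if n = m then 1 else 0)"
proof -
  have "sapp (psi_tilde m t0) = (\<lambda>t. (1 / fact m) * complex_of_real (t - t0) ^ m)"
    by (simp add: psi_tilde.rep_eq)
  \<comment> \<open>At the centre only a power of 0 remains; it vanishes exactly when
    \<open>n < m\<close>.\<close>
  then have "sapp (sderiv n (psi_tilde m t0)) t0
      = (1 / fact m) * of_nat (\<Prod>i<n. m - i) * 0 ^ (m - n)"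
    by (simp only: sderiv.rep_eq vderiv_pow_monomial) simp
  also have "\<dots> = (if n = m then 1 else 0)"
  proof (cases n m rule: linorder_cases)
    case less
    then show ?thesis by simp
  next
    case equal
    have "(\<Prod>i<m. m - i) = fact m"
      by (simp add: fact_prod_rev atLeast0LessThan)
    with equal show ?thesis by simp
  next
    case greater
    \<comment> \<open>Here \<open>m - n\<close> truncates to 0 and \<open>0 ^ 0 = 1\<close>, so the
      product has to supply the zero.\<close>
    then have "(\<Prod>i<n. m - i) = 0"
      by (auto simp: prod_zero_iff)
    with greater show ?thesis by simp
  qed
  finally show ?thesis .
qed

theorem proposition1:
  fixes n m :: nat and t0 :: real
  assumes "n \<ge> 1" and "m \<ge> 1"
  shows "pairing (psi_tilde m t0) (psi n t0) = (if n = m then 1 else 0)"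
proof -
  have "pairing (psi_tilde m t0) (psi n t0)
      = (-1) ^ n * ((-1) ^ n * sapp (sderiv n (psi_tilde m t0)) t0)"
    by (simp add: pairing_def psi_def dist_scale.rep_eq dist_deriv.rep_eq dirac.rep_eq)
  \<comment> \<open>The two signs multiply to \<open>((-1) * (-1)) ^ n = 1\<close>.\<close>
  also have "\<dots> = sapp (sderiv n (psi_tilde m t0)) t0"
    by (simp flip: mult.assoc power_mult_distrib)
  finally show ?thesis
    by (simp only: sderiv_psi_tilde_center)
qed

end
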